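(* Let $q\ge 1$ and let $\mathbf{n}=(n_1,\dots,n_d)$ be a vector of positive integers. The number of necklaces of size $\mathbf{n}$ over an alphabet of size $q$ is $$|\mathcal{N}_q^{\mathbf{n}}| = \frac{1}{N} \sum_{f_1 \mid n_1} \phi(f_1) \sum_{f_2 \mid n_2} \phi(f_2) \cdots \sum_{f_d \mid n_d} \phi(f_d)\, q^{N/\operatorname{lcm}(f_1, f_2, \dots, f_d)},$$ where $N = \prod_{i=1}^d n_i$ and $\phi$ is Euler's totient function.
   Context: Let $\Sigma=\{1,\dots,q\}$. A word of size $\mathbf{n}=(n_1,\dots,n_d)$ is an array $w=(w_p)$ of symbols of $\Sigma$ indexed by positions $p=(p_1,\dots,p_d)$ with $1\le p_i\le n_i$; $\Sigma^{\mathbf{n}}$ is the set of all such words. The $i$-th coordinate of a position is read modulo $n_i$. The group of translations is $Z_{\mathbf{n}}=Z_{n_1}\times\dots\times Z_{n_d}$ (product of cyclic groups); for $g\in Z_{\mathbf{n}}$ the translation of $w$ by $g$ is the word $\langle w\rangle_g$ with $(\langle w\rangle_g)_p=w_{p+g}$. A (multidimensional) necklace of size $\mathbf{n}$ is an equivalence class (orbit) of words of $\Sigma^{\mathbf{n}}$ under translation; $\mathcal{N}_q^{\mathbf{n}}$ is the set of all necklaces of size $\mathbf{n}$. The paper tacitly orders dimensions so that $n_1\le n_2\le\dots\le n_d$. *)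

theory Defs
  imports
    "HOL-Algebra.Group_Action"
    "HOL-Algebra.Product_Groups"
    "HOL-Number_Theory.Totient"
begin

text \<open>
  A size vector is a list \<open>ns\<close> of length \<open>d\<close>; its \<open>d\<close> dimensions are indexed by \<open>{..<d}\<close>.
  Positions and words are extensional functions, so that distinct functions are distinct
  positions or words. A position has coordinates \<open>1, \<dots>, n\<^sub>i\<close>, taken in \<open>int\<close> so that elements
  of \<open>integer_mod_group\<close> can be added to them.
\<close>

definition positions :: "nat list \<Rightarrow> (nat \<Rightarrow> int) set" where
  "positions ns = (\<Pi>\<^sub>E i\<in>{..<length ns}. {1..int (ns ! i)})"

definition words :: "nat \<Rightarrow> nat list \<Rightarrow> ((nat \<Rightarrow> int) \<Rightarrow> nat) set" where
  "words q ns = (\<Pi>\<^sub>E p\<in>positions ns. {1..q})"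

definition translation_group :: "nat list \<Rightarrow> (nat \<Rightarrow> int) monoid" where
  "translation_group ns = product_group {..<length ns} (\<lambda>i. integer_mod_group (ns ! i))"

text \<open>
  Coordinates are read modulo \<open>n\<^sub>i\<close>; the representative of \<open>x\<close> in \<open>{1..n\<^sub>i}\<close> is
  \<open>(x - 1) mod n\<^sub>i + 1\<close>.
\<close>

definition shift :: "nat list \<Rightarrow> (nat \<Rightarrow> int) \<Rightarrow> (nat \<Rightarrow> int) \<Rightarrow> nat \<Rightarrow> int" where
  "shift ns g p = (\<lambda>i\<in>{..<length ns}. (p i + g i - 1) mod int (ns ! i) + 1)"

text \<open>
  Restricting to \<open>words q ns\<close> does not affect the orbits; the library's \<open>group_action\<close>
  requires it.
\<close>

definition translation ::
    "nat \<Rightarrow> nat list \<Rightarrow> (nat \<Rightarrow> int) \<Rightarrow> ((nat \<Rightarrow> int) \<Rightarrow> nat) \<Rightarrow> (nat \<Rightarrow> int) \<Rightarrow> nat" where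
  "translation q ns g = (\<lambda>w\<in>words q ns. \<lambda>p\<in>positions ns. w (shift ns g p))"

definition necklaces :: "nat \<Rightarrow> nat list \<Rightarrow> ((nat \<Rightarrow> int) \<Rightarrow> nat) set set" where
  "necklaces q ns = orbits (translation_group ns) (words q ns) (translation q ns)"

text \<open>
  \<open>nested_totient_sum [n\<^sub>1, \<dots>, n\<^sub>d] F\<close> is the \<open>d\<close>-fold nested sum
  \<open>\<Sum>f\<^sub>1 | f\<^sub>1 dvd n\<^sub>1. totient f\<^sub>1 * (\<dots> (\<Sum>f\<^sub>d | f\<^sub>d dvd n\<^sub>d. totient f\<^sub>d * F [f\<^sub>1, \<dots>, f\<^sub>d]) \<dots>)\<close>.
\<close>

primrec nested_totient_sum :: "nat list \<Rightarrow> (nat list \<Rightarrow> real) \<Rightarrow> real" where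
  "nested_totient_sum [] F = F []"
| "nested_totient_sum (n # ns) F =
     (\<Sum>f | f dvd n. real (totient f) * nested_totient_sum ns (\<lambda>fs. F (f # fs)))"

end

theory Submission
  imports Defs
begin

text \<open>
  Necklaces are the orbits of the translation group on words, so by Burnside's lemma their
  number is the average, over the \<open>N\<close> translations, of the number of words fixed by a
  translation.

  A word is fixed by the translation by \<open>g\<close> iff it is constant on the cycles of the permutation
  \<open>p \<mapsto> p + g\<close> of the positions. Since \<open>p + k g = p\<close> means \<open>k g = 0\<close>, whatever \<open>p\<close> is,
  all these cycles have the same length, the order of \<open>g\<close>. This order is
  \<open>lcm(f\<^sub>1, \<dots>, f\<^sub>d)\<close>, where \<open>f\<^sub>i = n\<^sub>i / gcd(g\<^sub>i, n\<^sub>i)\<close> is the order of \<open>g\<^sub>i\<close> in the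
  integers modulo \<open>n\<^sub>i\<close>. Hence there are \<open>N / lcm(f\<^sub>1, \<dots>, f\<^sub>d)\<close> cycles, and a fixed word
  amounts to a choice of one symbol for each of them (\<open>card_invariants_translation\<close>, from the
  purely combinatorial \<open>card_invariant_functions\<close>).

  The number of fixed words thus depends on the orders \<open>f\<^sub>i\<close> only. As there are exactly
  \<open>\<phi>(f)\<close> residues modulo \<open>n\<close> of each order \<open>f\<close> dividing \<open>n\<close>, grouping the translations by
  these orders, one coordinate at a time, turns the sum over the group into the nested totient
  sum (\<open>sum_cyclic_orders\<close>).
\<close>

section \<open>Functions constant along the orbits of a permutation\<close>

text \<open>
  The universal property of a quotient: a function that respects \<open>R\<close> factors uniquely through
  the projection to \<open>P // R\<close>.
\<close>

lemma bij_betw_PiE_quotient: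
  assumes "equiv P R"
  shows "bij_betw (\<lambda>u. \<lambda>p\<in>P. u (R `` {p})) (P // R \<rightarrow>\<^sub>E A)
           {w \<in> P \<rightarrow>\<^sub>E A. \<forall>(x, y) \<in> R. w x = w y}"
proof (rule bij_betwI')
  fix u v assume u: "u \<in> P // R \<rightarrow>\<^sub>E A" and v: "v \<in> P // R \<rightarrow>\<^sub>E A"
  show "((\<lambda>p\<in>P. u (R `` {p})) = (\<lambda>p\<in>P. v (R `` {p}))) = (u = v)"
  proof
    assume eq: "(\<lambda>p\<in>P. u (R `` {p})) = (\<lambda>p\<in>P. v (R `` {p}))"
    show "u = v"
    proof (rule PiE_ext[OF u v])
      fix c assume "c \<in> P // R"
      then obtain p where p: "p \<in> P" "c = R `` {p}" by (auto elim: quotientE)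
      with fun_cong[OF eq, of p] show "u c = v c" by simp
    qed
  qed simp
next
  fix u assume u: "u \<in> P // R \<rightarrow>\<^sub>E A"
  have "R \<subseteq> P \<times> P" using assms by (auto simp: equiv_def)
  moreover have "R `` {x} = R `` {y}" if "(x, y) \<in> R" for x y
    using assms that by (rule equiv_class_eq)
  ultimately show "(\<lambda>p\<in>P. u (R `` {p})) \<in> {w \<in> P \<rightarrow>\<^sub>E A. \<forall>(x, y) \<in> R. w x = w y}"
    using u by (auto simp: quotientI PiE_iff)
next
  fix w assume w: "w \<in> {w \<in> P \<rightarrow>\<^sub>E A. \<forall>(x, y) \<in> R. w x = w y}"
  define u where "u = (\<lambda>c\<in>P // R. w (SOME x. x \<in> c))"
  have rep: "(SOME x. x \<in> c) \<in> c \<and> c \<subseteq> P" if "c \<in> P // R" for c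
    using assms that by (metis Union_quotient Union_upper in_quotient_imp_non_empty some_in_eq)
  have "u \<in> P // R \<rightarrow>\<^sub>E A"
    using rep w unfolding u_def by (auto simp: PiE_iff)
  moreover have "w p = u (R `` {p})" if "p \<in> P" for p
    using rep[OF quotientI[OF that, of R]] w that by (auto simp: u_def quotientI)
  then have "w = (\<lambda>p\<in>P. u (R `` {p}))"
    using w by (auto simp: PiE_iff extensional_def)
  ultimately show "\<exists>u\<in>P // R \<rightarrow>\<^sub>E A. w = (\<lambda>p\<in>P. u (R `` {p}))" by blast
qed

text \<open>
  The hypothesis on periods makes \<open>s\<close> a permutation of \<open>P\<close> all of whose cycles have length \<open>L\<close>.
  So there are \<open>card P div L\<close> cycles, and an \<open>s\<close>-invariant function is a free choice of one
  value per cycle.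
\<close>

lemma card_invariant_functions:
  fixes s :: "'a \<Rightarrow> 'a" and A :: "'b set"
  assumes fin: "finite P" and maps: "s ` P \<subseteq> P" and L: "L > 0"
    and period: "\<And>p k. p \<in> P \<Longrightarrow> (s ^^ k) p = p \<longleftrightarrow> L dvd k"
  shows "card {w \<in> P \<rightarrow>\<^sub>E A. \<forall>p\<in>P. w (s p) = w p} = card A ^ (card P div L)"
proof -
  define R where "R = {(x, y). x \<in> P \<and> (\<exists>k. y = (s ^^ k) x)}"
  have iter: "(s ^^ k) p \<in> P" if "p \<in> P" for p k
    using that maps by (induction k) auto
  have iter_mod: "(s ^^ (k mod L)) p = (s ^^ k) p" if "p \<in> P" for p k
  proof -
    have "(s ^^ k) p = (s ^^ (k mod L + L * (k div L))) p" by simp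
    also have "\<dots> = (s ^^ (k mod L)) p"
      using period[OF that, of "L * (k div L)"] by (simp only: funpow_add o_apply) simp
    finally show ?thesis by simp
  qed
  have iter_inj: "j = k" if "p \<in> P" "j < L" "k < L" "(s ^^ j) p = (s ^^ k) p" for p j k
    using that
  proof (induction j k rule: linorder_wlog)
    case (le j k)
    have "(s ^^ (k - j)) ((s ^^ j) p) = (s ^^ (k - j + j)) p"
      by (simp only: funpow_add o_apply)
    also have "\<dots> = (s ^^ j) p" using le by simp
    finally have "(s ^^ (k - j)) ((s ^^ j) p) = (s ^^ j) p" .
    then have "L dvd k - j"
      using period iter le.prems by blast
    then show ?case
      using le by (cases "k = j") (auto dest: dvd_imp_le)
  qed auto
  have equiv: "equiv P R"
  proof (rule equivI)
    show "R \<subseteq> P \<times> P" using iter by (auto simp: R_def)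
    show "refl_on P R" by (auto simp: R_def refl_on_def intro: exI[of _ 0])
    show "trans R"
    proof (rule transI)
      fix x y z assume "(x, y) \<in> R" "(y, z) \<in> R"
      then obtain j k where x: "x \<in> P" and "y = (s ^^ j) x" "z = (s ^^ k) y" by (auto simp: R_def)
      then have "z = (s ^^ (k + j)) x" by (simp add: funpow_add)
      with x show "(x, z) \<in> R" by (auto simp: R_def)
    qed
    show "sym R"
    proof (rule symI)
      fix x y assume "(x, y) \<in> R"
      then obtain k where x: "x \<in> P" and y: "y = (s ^^ k) x" by (auto simp: R_def)
      \<comment> \<open>A multiple of the period that is at least \<open>k\<close> leads from \<open>y\<close> back to \<open>x\<close>.\<close>
      have "L * k - k + k = L * k" using L by simp
      then have "(s ^^ (L * k - k)) y = (s ^^ (L * k)) x"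
        unfolding y by (metis funpow_add o_apply)
      also have "\<dots> = x" using period[OF x] by simp
      finally have "x = (s ^^ (L * k - k)) y" by simp
      moreover have "y \<in> P" using iter[OF x] y by simp
      ultimately show "(y, x) \<in> R" unfolding R_def by blast
    qed
  qed
  have card_class: "card c = L" if "c \<in> P // R" for c
  proof -
    obtain p where p: "p \<in> P" "c = R `` {p}" using \<open>c \<in> P // R\<close> by (auto elim: quotientE)
    have "c = (\<lambda>k. (s ^^ k) p) ` {..<L}"
    proof
      show "c \<subseteq> (\<lambda>k. (s ^^ k) p) ` {..<L}"
      proof
        fix x assume "x \<in> c"
        then obtain k where "x = (s ^^ k) p" using p by (auto simp: R_def)
        then have "x = (s ^^ (k mod L)) p" using iter_mod p by simp
        then show "x \<in> (\<lambda>k. (s ^^ k) p) ` {..<L}" using L by simp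
      qed
    qed (use p in \<open>auto simp: R_def\<close>)
    moreover have "inj_on (\<lambda>k. (s ^^ k) p) {..<L}"
      using iter_inj p by (auto intro: inj_onI)
    ultimately show ?thesis by (simp add: card_image)
  qed
  have finQ: "finite (P // R)"
    using fin equiv by (simp add: finite_quotient equiv_type)
  have "L * card (P // R) = card (\<Union> (P // R))"
    using equiv fin card_class finQ quotient_disj[OF equiv]
    by (intro card_partition) (auto simp: Union_quotient)
  then have quot: "card (P // R) = card P div L"
    using L by (metis Union_quotient[OF equiv] nonzero_mult_div_cancel_left less_not_refl)
  have const: "w ((s ^^ k) p) = w p" if "\<forall>p\<in>P. w (s p) = w p" "p \<in> P" for w :: "'a \<Rightarrow> 'b" and k p
    using that iter by (induction k) auto
  have "{w \<in> P \<rightarrow>\<^sub>E A. \<forall>p\<in>P. w (s p) = w p} = {w \<in> P \<rightarrow>\<^sub>E A. \<forall>(x, y) \<in> R. w x = w y}"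
  proof (intro Collect_cong conj_cong refl iffI ballI)
    fix w p assume w: "\<forall>(x, y) \<in> R. w x = w y" and p: "p \<in> P"
    have "(p, s p) \<in> R" unfolding R_def using p by (auto intro: exI[of _ 1])
    with w show "w (s p) = w p" by auto
  qed (auto simp: R_def const)
  also have "card \<dots> = card (P // R \<rightarrow>\<^sub>E A)"
    using bij_betw_PiE_quotient[OF equiv] by (rule bij_betw_same_card[symmetric])
  also have "\<dots> = card A ^ (card P div L)"
    using finQ by (simp add: card_PiE quot)
  finally show ?thesis .
qed

section \<open>Translations\<close>

lemma shift_in_positions:
  assumes "\<forall>n\<in>set ns. n \<ge> 1"
  shows "shift ns g p \<in> positions ns"
proof -
  have "int (ns ! i) > 0" if "i < length ns" for i
    using assms that by (metis nth_mem of_nat_0_less_iff less_eq_Suc_le One_nat_def)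
  then have "0 \<le> x mod int (ns ! i) \<and> x mod int (ns ! i) + 1 \<le> int (ns ! i)"
    if "i < length ns" for i x using that
    by (metis pos_mod_sign pos_mod_bound zless_imp_add1_zle)
  then show ?thesis by (simp add: shift_def positions_def PiE_iff)
qed

text \<open>
  Here, as in the next lemmas, the translation vectors are arbitrary integer vectors. This
  avoids reducing sums and multiples of translations modulo the dimensions.
\<close>

lemma shift_shift: "shift ns g (shift ns h p) = shift ns (\<lambda>i. g i + h i) p"
proof -
  have "((p i + h i - 1) mod m + 1 + g i - 1) mod m = (p i + (g i + h i) - 1) mod m" for i and m :: int
  proof -
    have "((p i + h i - 1) mod m + 1 + g i - 1) mod m = ((p i + h i - 1) mod m + g i) mod m" by simp
    also have "\<dots> = (p i + h i - 1 + g i) mod m" by (rule mod_add_left_eq)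
    finally show ?thesis by (simp add: algebra_simps)
  qed
  then show ?thesis by (auto simp: shift_def)
qed

lemma shift_eq_self_iff:
  assumes "p \<in> positions ns"
  shows "shift ns g p = p \<longleftrightarrow> (\<forall>i<length ns. int (ns ! i) dvd g i)"
proof -
  have "(p i + g i - 1) mod int (ns ! i) + 1 = p i \<longleftrightarrow> int (ns ! i) dvd g i"
    if "i < length ns" for i
  proof -
    have "1 \<le> p i \<and> p i \<le> int (ns ! i)"
      using assms that by (auto simp: positions_def PiE_iff)
    then have "(p i - 1) mod int (ns ! i) = p i - 1"
      by (intro mod_pos_pos_trivial) auto
    then have "(p i + g i - 1) mod int (ns ! i) + 1 = p i \<longleftrightarrow>
        (p i - 1 + g i) mod int (ns ! i) = (p i - 1) mod int (ns ! i)"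
      by (auto simp: algebra_simps)
    also have "\<dots> \<longleftrightarrow> int (ns ! i) dvd g i"
      by (simp add: mod_eq_dvd_iff)
    finally show ?thesis .
  qed
  moreover have "shift ns g p = p \<longleftrightarrow>
      (\<forall>i<length ns. (p i + g i - 1) mod int (ns ! i) + 1 = p i)"
    using assms by (auto simp: shift_def positions_def PiE_iff extensional_def fun_eq_iff)
  ultimately show ?thesis by simp
qed

lemma funpow_shift:
  assumes "p \<in> positions ns"
  shows "(shift ns g ^^ k) p = shift ns (\<lambda>i. int k * g i) p"
proof (induction k)
  case 0
  show ?case using assms by (simp add: shift_eq_self_iff[THEN iffD2])
next
  case (Suc k)
  then show ?case by (simp add: shift_shift algebra_simps)
qed

lemma shift_mult:
  "shift ns (g \<otimes>\<^bsub>translation_group ns\<^esub> h) p = shift ns (\<lambda>i. g i + h i) p"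
proof -
  have "(p i + (g i + h i) mod m - 1) mod m = (p i + (g i + h i) - 1) mod m" for i and m :: int
  proof -
    have "(p i + (g i + h i) mod m - 1) mod m = ((g i + h i) mod m + (p i - 1)) mod m"
      by (simp add: algebra_simps)
    also have "\<dots> = (g i + h i + (p i - 1)) mod m" by (rule mod_add_left_eq)
    finally show ?thesis by (simp add: algebra_simps)
  qed
  then show ?thesis by (auto simp: shift_def translation_group_def)
qed

lemma group_translation_group: "group (translation_group ns)"
  by (simp add: translation_group_def)

lemma carrier_translation_group:
  assumes "\<forall>n\<in>set ns. n \<ge> 1"
  shows "carrier (translation_group ns) = (\<Pi>\<^sub>E i\<in>{..<length ns}. {0..<int (ns ! i)})"
  unfolding translation_group_def carrier_product_group
proof (rule PiE_cong)
  fix i assume "i \<in> {..<length ns}"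
  then have "ns ! i \<noteq> 0" using assms by (metis lessThan_iff not_one_le_zero nth_mem)
  then show "carrier (integer_mod_group (ns ! i)) = {0..<int (ns ! i)}"
    by (simp add: carrier_integer_mod_group)
qed

text \<open>
  Translating by \<open>h\<close> and then by \<open>g\<close> evaluates the word at \<open>(p + g) + h\<close>: the order of the two
  is reversed, which is harmless because the group is commutative.
\<close>

lemma group_action_translation:
  assumes "\<forall>n\<in>set ns. n \<ge> 1"
  shows "group_action (translation_group ns) (words q ns) (translation q ns)"
proof -
  let ?G = "translation_group ns" and ?W = "words q ns"
  interpret group ?G by (rule group_translation_group)
  have maps: "translation q ns g w \<in> ?W" if "w \<in> ?W" for g w
    using that shift_in_positions[OF assms] by (auto simp: translation_def words_def PiE_iff)
  have comp: "translation q ns g (translation q ns h w) = translation q ns (g \<otimes>\<^bsub>?G\<^esub> h) w"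
    if "w \<in> ?W" for g h w
    using that maps[OF that] shift_in_positions[OF assms]
    by (auto simp: translation_def shift_shift shift_mult add.commute)
  have one: "translation q ns \<one>\<^bsub>?G\<^esub> w = w" if "w \<in> ?W" for w
  proof -
    have "shift ns \<one>\<^bsub>?G\<^esub> p = p" if "p \<in> positions ns" for p
      using that by (simp add: shift_eq_self_iff translation_group_def)
    then show ?thesis using \<open>w \<in> ?W\<close> by (auto simp: translation_def words_def PiE_iff extensional_def)
  qed
  have bij: "translation q ns g \<in> Bij ?W" if g: "g \<in> carrier ?G" for g
  proof -
    have "bij_betw (translation q ns g) ?W ?W"
      using g by (intro bij_betw_byWitness[where f' = "translation q ns (inv\<^bsub>?G\<^esub> g)"])
        (auto simp: comp one maps)
    then show ?thesis by (simp add: Bij_def translation_def)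
  qed
  have "translation q ns (g \<otimes>\<^bsub>?G\<^esub> h) = compose ?W (translation q ns g) (translation q ns h)" for g h
    by (rule extensionalityI[of _ ?W]) (auto simp: compose_eq comp, simp add: translation_def)
  then have "translation q ns \<in> hom ?G (BijGroup ?W)"
    using bij by (auto simp: hom_def BijGroup_def)
  then show ?thesis
    by (simp add: group_action_def group_hom_def group_hom_axioms_def group_BijGroup
        group_translation_group)
qed

section \<open>Words fixed by a translation\<close>

text \<open>
  Entry \<open>i\<close> is the order of \<open>g i\<close> as an element of the cyclic group of integers modulo \<open>ns ! i\<close>,
  in a closed form that relates it to the counting of integers by their gcd.
\<close>

definition cyclic_orders :: "nat list \<Rightarrow> (nat \<Rightarrow> int) \<Rightarrow> nat list" where
  "cyclic_orders ns g = map (\<lambda>i. ns ! i div gcd (nat (g i)) (ns ! i)) [0..<length ns]"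

text \<open>
  \<open>n div gcd a n\<close> is the additive order of \<open>a\<close> modulo \<open>n\<close>: after cancelling the gcd, what is left
  of \<open>n\<close> is coprime to what is left of \<open>a\<close>, and so must divide \<open>k\<close>.
\<close>

lemma dvd_mult_iff_div_gcd_dvd:
  fixes a k n :: nat
  assumes "n > 0"
  shows "n dvd k * a \<longleftrightarrow> n div gcd a n dvd k"
proof -
  define d where "d = gcd a n"
  have "d > 0" using assms by (simp add: d_def)
  have "n = d * (n div d)" "a = d * (a div d)" by (simp_all add: d_def)
  then have "n dvd k * a \<longleftrightarrow> d * (n div d) dvd d * (k * (a div d))"
    by (metis mult.left_commute)
  also have "\<dots> \<longleftrightarrow> n div d dvd k * (a div d)" using \<open>d > 0\<close> by simp
  also have "\<dots> \<longleftrightarrow> n div d dvd k"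
    using div_gcd_coprime[of a n] assms by (simp add: d_def coprime_dvd_mult_left_iff coprime_commute)
  finally show ?thesis by (simp add: d_def)
qed

lemma card_positions: "card (positions ns) = prod_list ns"
  by (simp add: positions_def card_PiE prod.list_conv_set_nth atLeast0LessThan)

lemma finite_positions: "finite (positions ns)"
  by (simp add: positions_def finite_PiE)

text \<open>
  Returning to a position after \<open>k\<close> steps means that each coordinate returns, that is, that each
  of the cyclic orders divides \<open>k\<close>. So every cycle has their least common multiple as its length.
\<close>

lemma card_invariants_translation:
  assumes "\<forall>n\<in>set ns. n \<ge> 1" and g: "g \<in> carrier (translation_group ns)"
  shows "card (invariants (words q ns) (translation q ns) g) =
           q ^ (prod_list ns div Lcm (set (cyclic_orders ns g)))"
proof -
  let ?L = "Lcm (set (cyclic_orders ns g))"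
  have pos: "ns ! i > 0" if "i < length ns" for i
    using assms(1) that by (metis less_le_trans nth_mem zero_less_one)
  have nonneg: "g i \<ge> 0" if "i < length ns" for i
    using g that by (auto simp: carrier_translation_group[OF assms(1)] PiE_iff)
  have "ns ! i div gcd (nat (g i)) (ns ! i) \<noteq> 0" if "i < length ns" for i
    using pos[OF that] by (simp add: dvd_div_eq_0_iff)
  then have "0 \<notin> set (cyclic_orders ns g)"
    by (fastforce simp: cyclic_orders_def simp del: div_eq_0_iff)
  then have "?L > 0"
    by (simp add: Lcm_0_iff zero_less_iff_neq_zero)
  have period: "(shift ns g ^^ k) p = p \<longleftrightarrow> ?L dvd k" if "p \<in> positions ns" for p k
  proof -
    have "int (ns ! i) dvd int k * g i \<longleftrightarrow> ns ! i div gcd (nat (g i)) (ns ! i) dvd k"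
      if "i < length ns" for i
    proof -
      have "int k * g i = int (k * nat (g i))" using nonneg[OF that] by simp
      then show ?thesis
        using dvd_mult_iff_div_gcd_dvd[OF pos[OF that]] by (simp only: int_dvd_int_iff)
    qed
    then show ?thesis
      using that by (auto simp: funpow_shift shift_eq_self_iff Lcm_dvd_iff cyclic_orders_def)
  qed
  have "translation q ns g w = w \<longleftrightarrow> (\<forall>p\<in>positions ns. w (shift ns g p) = w p)"
    if w: "w \<in> words q ns" for w
  proof -
    have "w \<in> extensional (positions ns)" using w by (simp add: words_def PiE_iff)
    then have "(\<lambda>p\<in>positions ns. w (shift ns g p)) = w \<longleftrightarrow>
        (\<forall>p\<in>positions ns. w (shift ns g p) = w p)"
      by (metis restrict_apply' restrict_ext extensional_restrict)
    then show ?thesis using w by (simp add: translation_def)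
  qed
  then have "invariants (words q ns) (translation q ns) g =
      {w \<in> positions ns \<rightarrow>\<^sub>E {1..q}. \<forall>p\<in>positions ns. w (shift ns g p) = w p}"
    unfolding invariants_def by (auto simp: words_def)
  also have "card \<dots> = card {1..q} ^ (card (positions ns) div ?L)"
    using shift_in_positions[OF assms(1)] \<open>?L > 0\<close> period finite_positions
    by (intro card_invariant_functions) auto
  finally show ?thesis by (simp add: card_positions)
qed

section \<open>Summation over a product of cyclic groups\<close>

text \<open>
  Grouping the residues by their order \<open>f\<close>: those of order \<open>f\<close> have gcd \<open>n div f\<close> with \<open>n\<close>, and
  there are \<open>totient (n div (n div f)) = totient f\<close> of them.
\<close>

lemma sum_cyclic_order:
  fixes h :: "nat \<Rightarrow> real"
  assumes "n \<ge> 1"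
  shows "(\<Sum>x\<in>{0..<int n}. h (n div gcd (nat x) n)) = (\<Sum>f | f dvd n. real (totient f) * h f)"
proof -
  \<comment> \<open>The count by gcd (\<open>card_gcd_eq_totient\<close>) is about \<open>{0<..n}\<close>, so the residue 0 is replaced by \<open>n\<close>.\<close>
  have "(\<Sum>x\<in>{0..<int n}. h (n div gcd (nat x) n)) = (\<Sum>k\<in>{0<..n}. h (n div gcd k n))"
    by (rule sum.reindex_bij_witness[of _ "\<lambda>k. int (k mod n)" "\<lambda>x. if x = 0 then n else nat x"])
      (use assms in \<open>auto simp: nat_less_iff le_eq_less_or_eq\<close>)
  also have "\<dots> = (\<Sum>f | f dvd n. \<Sum>k | k \<in> {0<..n} \<and> n div gcd k n = f. h (n div gcd k n))"
    using assms by (intro sum.group[symmetric]) (auto intro: dvdI[OF dvd_div_mult_self[symmetric]])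
  also have "\<dots> = (\<Sum>f | f dvd n. real (totient f) * h f)"
  proof (rule sum.cong[OF refl])
    fix f assume "f \<in> {f. f dvd n}"
    then have f: "f dvd n" by simp
    have "n div gcd k n = f \<longleftrightarrow> gcd k n = n div f" for k
    proof -
      obtain e where e: "n = gcd k n * e" using gcd_dvd2 by (rule dvdE)
      obtain c where c: "n = f * c" using f by (rule dvdE)
      have "gcd k n > 0" "f > 0" using assms f by (auto intro: Nat.gr0I)
      then have "n div gcd k n = e" "n div f = c"
        using e c by (metis nonzero_mult_div_cancel_left less_not_refl)+
      moreover have "e = f \<longleftrightarrow> gcd k n = c"
        using e c assms by (metis mult.commute mult_cancel_left not_one_le_zero mult_is_0)
      ultimately show ?thesis by simp
    qed
    then have "card {k \<in> {0<..n}. n div gcd k n = f} = card {k \<in> {0<..n}. gcd k n = n div f}"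
      by simp
    also have "\<dots> = totient (n div (n div f))"
      using f assms by (intro card_gcd_eq_totient) auto
    also have "n div (n div f) = f" using f assms by auto
    finally show "(\<Sum>k | k \<in> {0<..n} \<and> n div gcd k n = f. h (n div gcd k n)) = real (totient f) * h f"
      by simp
  qed
  finally show ?thesis .
qed

text \<open>
  A family indexed by \<open>{..<Suc m}\<close> is split into its head and its tail. This matches the
  recursion of \<open>nested_totient_sum\<close>, which peels off the first dimension.
\<close>

lemma sum_PiE_lessThan_Suc:
  fixes A :: "nat \<Rightarrow> 'a set"
  shows "(\<Sum>g\<in>(\<Pi>\<^sub>E i\<in>{..<Suc m}. A i). h g) =
   (\<Sum>a\<in>A 0. \<Sum>g\<in>(\<Pi>\<^sub>E i\<in>{..<m}. A (Suc i)). h (case_nat a g))"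
proof -
  have eta: "case_nat (g 0) (\<lambda>i. g (Suc i)) = g" for g :: "nat \<Rightarrow> 'a"
    by (rule ext) (simp split: nat.split)
  have uncons: "g 0 \<in> A 0 \<and> (\<lambda>i. g (Suc i)) \<in> (\<Pi>\<^sub>E i\<in>{..<m}. A (Suc i))"
    if "g \<in> (\<Pi>\<^sub>E i\<in>{..<Suc m}. A i)" for g
    using that by (simp add: PiE_iff extensional_def)
  have cons: "case_nat a g \<in> (\<Pi>\<^sub>E i\<in>{..<Suc m}. A i)"
    if "a \<in> A 0" "g \<in> (\<Pi>\<^sub>E i\<in>{..<m}. A (Suc i))" for a g
    using that by (simp add: PiE_iff extensional_def split: nat.split)
  have "(\<Sum>g\<in>(\<Pi>\<^sub>E i\<in>{..<Suc m}. A i). h g) =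
      (\<Sum>(a, g)\<in>A 0 \<times> (\<Pi>\<^sub>E i\<in>{..<m}. A (Suc i)). h (case_nat a g))"
    by (rule sum.reindex_bij_witness[of _ "\<lambda>(a, g). case_nat a g" "\<lambda>g. (g 0, \<lambda>i. g (Suc i))"])
      (simp_all only: case_prod_beta fst_conv snd_conv mem_Times_iff eta uncons cons
          nat.case surjective_pairing[symmetric] simp_thms)
  then show ?thesis by (simp only: sum.cartesian_product)
qed

lemma sum_cyclic_orders:
  assumes "\<forall>n\<in>set ns. n \<ge> 1"
  shows "(\<Sum>g\<in>(\<Pi>\<^sub>E i\<in>{..<length ns}. {0..<int (ns ! i)}). F (cyclic_orders ns g)) =
           nested_totient_sum ns F"
  using assms
proof (induction ns arbitrary: F)
  case Nil
  show ?case by (simp add: cyclic_orders_def)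
next
  case (Cons n ns)
  have "cyclic_orders (n # ns) (case_nat a g) = (n div gcd (nat a) n) # cyclic_orders ns g" for a g
    by (simp add: cyclic_orders_def map_upt_Suc del: upt_Suc)
  then have "(\<Sum>g\<in>(\<Pi>\<^sub>E i\<in>{..<length (n # ns)}. {0..<int ((n # ns) ! i)}). F (cyclic_orders (n # ns) g)) =
      (\<Sum>a\<in>{0..<int n}. \<Sum>g\<in>(\<Pi>\<^sub>E i\<in>{..<length ns}. {0..<int (ns ! i)}).
         F (n div gcd (nat a) n # cyclic_orders ns g))"
    by (simp only: length_Cons sum_PiE_lessThan_Suc nth_Cons_0 nth_Cons_Suc)
  also have "\<dots> = (\<Sum>a\<in>{0..<int n}. nested_totient_sum ns (\<lambda>fs. F (n div gcd (nat a) n # fs)))"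
    using Cons.prems by (intro sum.cong[OF refl] Cons.IH) simp
  also have "\<dots> = nested_totient_sum (n # ns) F"
    using Cons.prems sum_cyclic_order[where h = "\<lambda>f. nested_totient_sum ns (\<lambda>fs. F (f # fs))"]
    by simp
  finally show ?case .
qed

section \<open>The number of necklaces\<close>

theorem theorem1:
  fixes q N :: nat and ns :: "nat list"
  assumes "q \<ge> 1"
    and "\<forall>n\<in>set ns. n \<ge> 1"
    and "N = prod_list ns"
  shows "real (card (necklaces q ns)) =
    1 / real N * nested_totient_sum ns (\<lambda>fs. real q ^ (N div Lcm (set fs)))"
proof -
  let ?G = "translation_group ns"
  interpret group_action ?G "words q ns" "translation q ns"
    using assms(2) by (rule group_action_translation)
  have order: "order ?G = N"
    by (simp add: order_def carrier_translation_group[OF assms(2)] card_PiE assms(3)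
        prod.list_conv_set_nth atLeast0LessThan)
  have "N > 0"
    using assms(2,3) by (metis not_one_le_zero prod_list_zero_iff gr0I)
  have "card (necklaces q ns) * N =
      (\<Sum>g\<in>carrier ?G. card (invariants (words q ns) (translation q ns) g))"
    unfolding necklaces_def order[symmetric]
    by (rule burnside)
      (simp_all add: carrier_translation_group[OF assms(2)] words_def finite_PiE finite_positions)
  also have "real \<dots> = (\<Sum>g\<in>carrier ?G. real q ^ (N div Lcm (set (cyclic_orders ns g))))"
    by (simp add: card_invariants_translation[OF assms(2)] assms(3))
  also have "\<dots> = nested_totient_sum ns (\<lambda>fs. real q ^ (N div Lcm (set fs)))"
    unfolding carrier_translation_group[OF assms(2)] using assms(2)
    by (rule sum_cyclic_orders[where F = "\<lambda>fs. real q ^ (N div Lcm (set fs))"])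
  finally have "real (card (necklaces q ns)) * real N =
      nested_totient_sum ns (\<lambda>fs. real q ^ (N div Lcm (set fs)))" by simp
  then show ?thesis using \<open>N > 0\<close> by (simp add: field_simps)
qed

end
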